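(* Let $\mathrm{AG}$ be finite and nonempty, and let $X\in\{\epsilon,\mathtt S,\mathtt I,\mathtt D,\mathtt{SI},\mathtt{SD},\mathtt{ID},\mathtt{SID}\}$. Let $\mathcal N=(\mathrm{ST},\{N_C\}_{C\subseteq\mathrm{AG}})$ be an AC-abstract-representative actual neighborhood $X$-frame. Then there exists a general concurrent game $X$-frame $G=(\mathrm{ST},\mathrm{AC},\{\mathrm{av}_C\}_{C\subseteq \mathrm{AG}},\{\mathrm{out}_C\}_{C\subseteq \mathrm{AG}})$ (with the same state set) such that $G$ is AC-representable by $\mathcal N$, i.e. $\{\mathrm{out}_C(s,\sigma_C)\mid\sigma_C\in\mathrm{av}_C(s)\}=N_C(s)$ for every $s\in\mathrm{ST}$ and every $C\subseteq\mathrm{AG}$.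
   Context: Let $\mathrm{AG}$ be a finite nonempty set of agents; coalitions are subsets of $\mathrm{AG}$. **Game frames.** Given a nonempty action set $\mathrm{AC}$, $\mathrm{JA}_C$ is the set of functions $C\to\mathrm{AC}$ (so $\mathrm{JA}_\emptyset=\{\emptyset\}$); $\sigma|_C$ denotes restriction. An action frame is $(\mathrm{ST},\mathrm{AC},\{\mathrm{av}_C\}_{C\subseteq\mathrm{AG}},\{\mathrm{out}_C\}_{C\subseteq\mathrm{AG}})$ with $\mathrm{ST}$ and $\mathrm{AC}$ nonempty sets, $\mathrm{av}_C:\mathrm{ST}\to\mathcal P(\mathrm{JA}_C)$ and $\mathrm{out}_C:\mathrm{ST}\times\mathrm{JA}_C\to\mathcal P(\mathrm{ST})$. The action set $\mathrm{AC}$ may vary from frame to frame and need not be finite. It is a general concurrent game frame if for all $C\subseteq\mathrm{AG}$, $s\in\mathrm{ST}$: (GCI) for all $\sigma_C\in\mathrm{JA}_C$, $\mathrm{out}_C(s,\sigma_C)=\bigcup\{\mathrm{out}_{\mathrm{AG}}(s,\sigma)\mid\sigma\in\mathrm{JA}_{\mathrm{AG}},\ \sigma|_C=\sigma_C\}$; (ODA) $\mathrm{av}_C(s)=\{\sigma_C\in\mathrm{JA}_C\mid\mathrm{out}_C(s,\sigma_C)\neq\emptyset\}$. It is serial ($\mathtt S$) if $\mathrm{av}_C(s)\ne\emptyset$ for all $C,s$; independent ($\mathtt I$) if for all $s$ and all disjoint $C,D\subseteq\mathrm{AG}$, $\sigma_C\in\mathrm{av}_C(s)$ and $\sigma_D\in\mathrm{av}_D(s)$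 imply $\sigma_C\cup\sigma_D\in\mathrm{av}_{C\cup D}(s)$; deterministic ($\mathtt D$) if $\mathrm{out}_{\mathrm{AG}}(s,\sigma)$ is a singleton for all $s$ and $\sigma\in\mathrm{av}_{\mathrm{AG}}(s)$. For a string $X$ of the symbols $\mathtt S,\mathtt I,\mathtt D$ ($\epsilon$ is the empty string), an $X$-frame is a general concurrent game frame having every property whose symbol occurs in $X$ (the omitted properties are not required to fail). **Actual neighborhood frames.** An actual neighborhood frame is $\mathcal N=(\mathrm{ST},\{N_C\}_{C\subseteq\mathrm{AG}})$ with $\mathrm{ST}$ a nonempty set and $N_C:\mathrm{ST}\to\mathcal P(\mathcal P(\mathrm{ST}))$. **Abstract actual presentations.** An abstract actual presentation of $\mathcal N$ at $s$ is a tuple $\mathbb I_s=(I_s,o_s,\{\equiv^s_a\}_{a\in\mathrm{AG}})$ where $I_s$ is a (possibly empty) set, $o_s:I_s\to\mathcal P(\mathrm{ST})$, and each $\equiv^s_a$ is an equivalence relation on $I_s$. For $C\subseteq\mathrm{AG}$, $i\equiv^s_C j$ iff $i\equiv^s_a j$ for all $a\in C$ (universal relation if $C=\emptyset$), and $\rho^s_C(i)=\bigcup\{o_s(j)\mid j\in I_s,\ i\equiv^s_C j\}$. It must satisfy: (grand compatibility) $i\equiv^s_{\mathrm{AG}}j$ implies $o_s(i)=o_s(j)$; (coverage) $N_C(s)=\{\rho^s_C(i)\mid i\in I_s\}$ for every $C\subseteq\mathrm{AG}$. An abstract actual presentation of $\mathcal N$ is a family $\mathbb I=(\mathbb I_s)_{s\in\mathrm{ST}}$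 of such presentations, one at each $s$. It is amalgamating if for every $s$, all $i,j\in I_s$ and all disjoint $C,D\subseteq\mathrm{AG}$ there is $k\in I_s$ with $i\equiv^s_C k$ and $j\equiv^s_D k$. **AC-abstract-representativeness.** $\mathcal N$ is AC-abstract-representative if it has an abstract actual presentation and satisfies liveness: $\emptyset\notin N_C(s)$ for all $s,C$. Such an $\mathcal N$ is AC-abstract-serial if $N_C(s)\neq\emptyset$ for all $s,C$; AC-abstract-independent if it has an amalgamating abstract actual presentation; AC-abstract-deterministic if for every $s$ every element of $N_{\mathrm{AG}}(s)$ is a singleton. An AC-abstract-representative actual neighborhood $X$-frame is an AC-abstract-representative frame that is AC-abstract-serial if $\mathtt S$ occurs in $X$, AC-abstract-independent if $\mathtt I$ occurs in $X$, and AC-abstract-deterministic if $\mathtt D$ occurs in $X$. *)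

theory Defs
  imports Main
begin

text \<open>
  The finite nonempty set of agents is the type \<open>'ag :: finite\<close>; coalitions are its subsets, and
  the grand coalition is \<open>UNIV\<close>. State sets and action sets are explicit carrier sets, and nothing
  is required of the components of a frame at points outside these carriers.
\<close>

datatype frame_property = Serial | Independent | Deterministic


subsection \<open>Game frames\<close>

text \<open>
  A joint action \<open>\<sigma> : C \<rightarrow> AC\<close> is a partial map with domain exactly \<open>C\<close>, so that
  \<open>\<sigma> |` C\<close> is restriction and \<open>\<sigma> ++ \<tau>\<close> is the union of maps with disjoint domains.
\<close>

definition joint_actions :: "'ac set \<Rightarrow> 'ag set \<Rightarrow> ('ag \<rightharpoonup> 'ac) set" where
  "joint_actions AC C = {\<sigma>. dom \<sigma> = C \<and> ran \<sigma> \<subseteq> AC}"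

record ('ag, 's, 'ac) action_frame =
  states :: "'s set"
  actions :: "'ac set"
  av :: "'ag set \<Rightarrow> 's \<Rightarrow> ('ag \<rightharpoonup> 'ac) set"
  out :: "'ag set \<Rightarrow> 's \<Rightarrow> ('ag \<rightharpoonup> 'ac) \<Rightarrow> 's set"

abbreviation JA :: "('ag, 's, 'ac) action_frame \<Rightarrow> 'ag set \<Rightarrow> ('ag \<rightharpoonup> 'ac) set" where
  "JA G \<equiv> joint_actions (actions G)"

definition is_action_frame :: "('ag::finite, 's, 'ac) action_frame \<Rightarrow> bool" where
  "is_action_frame G \<longleftrightarrow>
     states G \<noteq> {} \<and> actions G \<noteq> {} \<and>
     (\<forall>C. \<forall>s\<in>states G. av G C s \<subseteq> JA G C) \<and>
     (\<forall>C. \<forall>s\<in>states G. \<forall>\<sigma>\<in>JA G C. out G C s \<sigma> \<subseteq> states G)"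

definition general_concurrent_game_frame :: "('ag::finite, 's, 'ac) action_frame \<Rightarrow> bool" where
  "general_concurrent_game_frame G \<longleftrightarrow>
     is_action_frame G \<and>
     (\<forall>C. \<forall>s\<in>states G. \<forall>\<sigma>C\<in>JA G C.
        out G C s \<sigma>C = \<Union> {out G UNIV s \<sigma> | \<sigma>. \<sigma> \<in> JA G UNIV \<and> \<sigma> |` C = \<sigma>C}) \<and>
     (\<forall>C. \<forall>s\<in>states G. av G C s = {\<sigma>C \<in> JA G C. out G C s \<sigma>C \<noteq> {}})"

definition serial :: "('ag::finite, 's, 'ac) action_frame \<Rightarrow> bool" where
  "serial G \<longleftrightarrow> (\<forall>C. \<forall>s\<in>states G. av G C s \<noteq> {})"

definition independent :: "('ag::finite, 's, 'ac) action_frame \<Rightarrow> bool" where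
  "independent G \<longleftrightarrow>
     (\<forall>s\<in>states G. \<forall>C D. C \<inter> D = {} \<longrightarrow>
        (\<forall>\<sigma>C\<in>av G C s. \<forall>\<sigma>D\<in>av G D s. \<sigma>C ++ \<sigma>D \<in> av G (C \<union> D) s))"

definition deterministic :: "('ag::finite, 's, 'ac) action_frame \<Rightarrow> bool" where
  "deterministic G \<longleftrightarrow> (\<forall>s\<in>states G. \<forall>\<sigma>\<in>av G UNIV s. is_singleton (out G UNIV s \<sigma>))"

definition game_X_frame ::
    "frame_property list \<Rightarrow> ('ag::finite, 's, 'ac) action_frame \<Rightarrow> bool" where
  "game_X_frame X G \<longleftrightarrow>
     general_concurrent_game_frame G \<and>
     (Serial \<in> set X \<longrightarrow> serial G) \<and>
     (Independent \<in> set X \<longrightarrow> independent G) \<and>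
     (Deterministic \<in> set X \<longrightarrow> deterministic G)"


subsection \<open>Actual neighborhood frames\<close>

record ('ag, 's) nbhd_frame =
  nstates :: "'s set"
  nbhd :: "'ag set \<Rightarrow> 's \<Rightarrow> 's set set"

definition actual_nbhd_frame :: "('ag::finite, 's) nbhd_frame \<Rightarrow> bool" where
  "actual_nbhd_frame N \<longleftrightarrow>
     nstates N \<noteq> {} \<and> (\<forall>C. \<forall>s\<in>nstates N. nbhd N C s \<subseteq> Pow (nstates N))"

definition AC_representable ::
    "('ag::finite, 's, 'ac) action_frame \<Rightarrow> ('ag, 's) nbhd_frame \<Rightarrow> bool" where
  "AC_representable G N \<longleftrightarrow>
     states G = nstates N \<and>
     (\<forall>s\<in>nstates N. \<forall>C. {out G C s \<sigma>C | \<sigma>C. \<sigma>C \<in> av G C s} = nbhd N C s)"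


subsection \<open>Abstract actual presentations\<close>

record ('ag, 's, 'i) presentation =
  idx :: "'i set"
  outcome :: "'i \<Rightarrow> 's set"
  eqv :: "'ag \<Rightarrow> ('i \<times> 'i) set"

definition coalition_eqv :: "('ag::finite, 's, 'i) presentation \<Rightarrow> 'ag set \<Rightarrow> ('i \<times> 'i) set" where
  "coalition_eqv P C = {(i, j). i \<in> idx P \<and> j \<in> idx P \<and> (\<forall>a\<in>C. (i, j) \<in> eqv P a)}"

definition rho :: "('ag::finite, 's, 'i) presentation \<Rightarrow> 'ag set \<Rightarrow> 'i \<Rightarrow> 's set" where
  "rho P C i = \<Union> {outcome P j | j. j \<in> idx P \<and> (i, j) \<in> coalition_eqv P C}"

definition presentation_at ::
    "('ag::finite, 's) nbhd_frame \<Rightarrow> 's \<Rightarrow> ('ag, 's, 'i) presentation \<Rightarrow> bool" where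
  "presentation_at N s P \<longleftrightarrow>
     (\<forall>i\<in>idx P. outcome P i \<subseteq> nstates N) \<and>
     (\<forall>a. equiv (idx P) (eqv P a)) \<and>
     (\<forall>i j. (i, j) \<in> coalition_eqv P UNIV \<longrightarrow> outcome P i = outcome P j) \<and>
     (\<forall>C. nbhd N C s = {rho P C i | i. i \<in> idx P})"

definition abstract_actual_presentation ::
    "('ag::finite, 's) nbhd_frame \<Rightarrow> ('s \<Rightarrow> ('ag, 's, 'i) presentation) \<Rightarrow> bool" where
  "abstract_actual_presentation N \<I> \<longleftrightarrow> (\<forall>s\<in>nstates N. presentation_at N s (\<I> s))"

definition amalgamating ::
    "('ag::finite, 's) nbhd_frame \<Rightarrow> ('s \<Rightarrow> ('ag, 's, 'i) presentation) \<Rightarrow> bool" where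
  "amalgamating N \<I> \<longleftrightarrow>
     (\<forall>s\<in>nstates N. \<forall>i\<in>idx (\<I> s). \<forall>j\<in>idx (\<I> s). \<forall>C D. C \<inter> D = {} \<longrightarrow>
        (\<exists>k\<in>idx (\<I> s). (i, k) \<in> coalition_eqv (\<I> s) C \<and> (j, k) \<in> coalition_eqv (\<I> s) D))"


subsection \<open>AC-abstract-representativeness\<close>

text \<open>
  HOL cannot quantify over types inside a formula, so the existence of a presentation is expressed
  relative to a type \<open>'i\<close> from which the index sets are drawn. The type is an arbitrary parameter:
  families of index sets from several types embed into a common sum type.
\<close>

definition AC_abstract_representative ::
    "'i itself \<Rightarrow> ('ag::finite, 's) nbhd_frame \<Rightarrow> bool" where
  "AC_abstract_representative T N \<longleftrightarrow>
     actual_nbhd_frame N \<and>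
     (\<exists>\<I> :: 's \<Rightarrow> ('ag, 's, 'i) presentation. abstract_actual_presentation N \<I>) \<and>
     (\<forall>s\<in>nstates N. \<forall>C. {} \<notin> nbhd N C s)"

definition AC_abstract_serial :: "('ag::finite, 's) nbhd_frame \<Rightarrow> bool" where
  "AC_abstract_serial N \<longleftrightarrow> (\<forall>s\<in>nstates N. \<forall>C. nbhd N C s \<noteq> {})"

definition AC_abstract_independent ::
    "'i itself \<Rightarrow> ('ag::finite, 's) nbhd_frame \<Rightarrow> bool" where
  "AC_abstract_independent T N \<longleftrightarrow>
     (\<exists>\<I> :: 's \<Rightarrow> ('ag, 's, 'i) presentation.
        abstract_actual_presentation N \<I> \<and> amalgamating N \<I>)"

definition AC_abstract_deterministic :: "('ag::finite, 's) nbhd_frame \<Rightarrow> bool" where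
  "AC_abstract_deterministic N \<longleftrightarrow> (\<forall>s\<in>nstates N. \<forall>Y\<in>nbhd N UNIV s. is_singleton Y)"

definition AC_abstract_representative_X_frame ::
    "'i itself \<Rightarrow> frame_property list \<Rightarrow> ('ag::finite, 's) nbhd_frame \<Rightarrow> bool" where
  "AC_abstract_representative_X_frame T X N \<longleftrightarrow>
     AC_abstract_representative T N \<and>
     (Serial \<in> set X \<longrightarrow> AC_abstract_serial N) \<and>
     (Independent \<in> set X \<longrightarrow> AC_abstract_independent T N) \<and>
     (Deterministic \<in> set X \<longrightarrow> AC_abstract_deterministic N)"

end

theory Submission
  imports Defs
begin

text \<open>
  Take the equivalence classes of the presentations as actions: at \<open>s\<close>, an index \<open>i\<close> stands for the
  profile in which every agent \<open>a\<close> plays the class of \<open>i\<close> under \<open>\<equiv>\<^sub>a\<close>, and a joint action of \<open>C\<close>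
  leads to the outcomes of all indices whose \<open>C\<close>-profile it is. Two indices have the same
  \<open>C\<close>-profile iff they are \<open>C\<close>-equivalent, so the \<open>C\<close>-profile of \<open>i\<close> has outcome \<open>\<rho>\<^sub>C(i)\<close>. Liveness
  makes the outcome of every index nonempty, so exactly the profiles of indices are available, and
  amalgamation is then independence.
\<close>

text \<open>One set of indices may be a class for several agents. This is harmless, since profiles
  are compared agent by agent.\<close>

definition profile :: "('ag, 's, 'i) presentation \<Rightarrow> 'ag set \<Rightarrow> 'i \<Rightarrow> ('ag \<rightharpoonup> 'i set)" where
  "profile P C i = (\<lambda>a. if a \<in> C then Some (eqv P a `` {i}) else None)"

text \<open>The action set is common to all states while the index sets vary, so every set of
  indices counts as an action; this also keeps \<open>actions\<close> nonempty if all index sets are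
  empty. A joint action that is the profile of no index gets the empty union as its outcome.\<close>

definition class_frame ::
    "'s set \<Rightarrow> ('s \<Rightarrow> ('ag, 's, 'i) presentation) \<Rightarrow> ('ag, 's, 'i set) action_frame" where
  "class_frame S \<I> =
     \<lparr>states = S, actions = UNIV,
      av = (\<lambda>C s. profile (\<I> s) C ` idx (\<I> s)),
      out = (\<lambda>C s \<sigma>. \<Union> {outcome (\<I> s) j | j. j \<in> idx (\<I> s) \<and> profile (\<I> s) C j = \<sigma>})\<rparr>"

lemma class_frame_sel [simp]:
  "states (class_frame S \<I>) = S"
  "actions (class_frame S \<I>) = UNIV"
  "av (class_frame S \<I>) C s = profile (\<I> s) C ` idx (\<I> s)"
  "out (class_frame S \<I>) C s \<sigma> =
     \<Union> {outcome (\<I> s) j | j. j \<in> idx (\<I> s) \<and> profile (\<I> s) C j = \<sigma>}"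
  by (simp_all add: class_frame_def)

lemma profile_in_joint_actions: "profile P C i \<in> joint_actions UNIV C"
  by (auto simp: joint_actions_def profile_def split: if_splits)

lemma profile_restrict: "profile P UNIV i |` C = profile P C i"
  by (auto simp: profile_def restrict_map_def)

lemma profile_Un: "profile P C i ++ profile P D i = profile P (C \<union> D) i"
  by (auto simp: profile_def map_add_def fun_eq_iff)

lemma profile_eq_iff:
  assumes "\<And>a. equiv (idx P) (eqv P a)" "i \<in> idx P" "j \<in> idx P"
  shows "profile P C i = profile P C j \<longleftrightarrow> (i, j) \<in> coalition_eqv P C"
proof -
  have "eqv P a `` {i} = eqv P a `` {j} \<longleftrightarrow> (i, j) \<in> eqv P a" for a
    using eq_equiv_class_iff[OF assms(1)] assms(2,3) by blast
  then show ?thesis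
    using assms(2,3) by (auto simp: profile_def coalition_eqv_def fun_eq_iff)
qed

text \<open>By grand compatibility every index in the union has the outcome of \<open>i\<close>, and
  by reflexivity \<open>i\<close> is among them.\<close>

lemma rho_UNIV:
  assumes "presentation_at N s P" "i \<in> idx P"
  shows "rho P UNIV i = outcome P i"
proof -
  have "(i, i) \<in> coalition_eqv P UNIV"
    using assms by (auto simp: presentation_at_def coalition_eqv_def equiv_def refl_on_def)
  then show ?thesis
    using assms unfolding presentation_at_def rho_def by blast
qed

lemma out_profile:
  assumes "presentation_at N s (\<I> s)" "i \<in> idx (\<I> s)"
  shows "out (class_frame S \<I>) C s (profile (\<I> s) C i) = rho (\<I> s) C i"
proof -
  have "profile (\<I> s) C j = profile (\<I> s) C i \<longleftrightarrow> (i, j) \<in> coalition_eqv (\<I> s) C"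
    if "j \<in> idx (\<I> s)" for j
    using assms that profile_eq_iff[of "\<I> s" i j C] by (auto simp: presentation_at_def)
  then show ?thesis
    by (auto simp: rho_def)
qed

lemma class_frame_general:
  assumes "nstates N \<noteq> {}"
    and pres: "\<And>s. s \<in> nstates N \<Longrightarrow> presentation_at N s (\<I> s)"
    and live: "\<And>s C. s \<in> nstates N \<Longrightarrow> {} \<notin> nbhd N C s"
  shows "general_concurrent_game_frame (class_frame (nstates N) \<I>)" (is "general_concurrent_game_frame ?G")
proof -
  have "is_action_frame ?G"
  proof -
    have "outcome (\<I> s) i \<subseteq> nstates N" if "s \<in> nstates N" "i \<in> idx (\<I> s)" for s i
      using pres[OF that(1)] that(2) unfolding presentation_at_def by blast
    then show ?thesis
      using assms(1) profile_in_joint_actions by (auto simp: is_action_frame_def)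
  qed
  moreover have "out ?G C s \<sigma>C =
      \<Union> {out ?G UNIV s \<sigma> | \<sigma>. \<sigma> \<in> JA ?G UNIV \<and> \<sigma> |` C = \<sigma>C}" for C s \<sigma>C
  proof -
    \<comment> \<open>For (GCI), each index has exactly one grand profile, and this restricts to its
      \<open>C\<close>-profile. Grouping the indices with \<open>C\<close>-profile
      \<open>\<sigma>C\<close> by their grand profiles therefore leaves the union unchanged.\<close>
    have "profile (\<I> s) C j = \<sigma>C \<longleftrightarrow>
        (\<exists>\<sigma>. \<sigma> \<in> joint_actions UNIV UNIV \<and> \<sigma> |` C = \<sigma>C \<and> profile (\<I> s) UNIV j = \<sigma>)" for j
      using profile_restrict[of "\<I> s" j C] profile_in_joint_actions[of "\<I> s" UNIV j] by auto
    then show ?thesis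
      by (simp only: class_frame_sel) blast
  qed
  moreover have "av ?G C s = {\<sigma>C \<in> JA ?G C. out ?G C s \<sigma>C \<noteq> {}}" if "s \<in> nstates N" for C s
  proof -
    have "outcome (\<I> s) i \<noteq> {}" if "i \<in> idx (\<I> s)" for i
    proof -
      \<comment> \<open>Liveness speaks of neighborhoods only. It reaches the outcome of
        \<open>i\<close> because this outcome is a neighborhood of the grand coalition.\<close>
      have "rho (\<I> s) UNIV i \<in> nbhd N UNIV s"
        using pres[OF \<open>s \<in> nstates N\<close>] that unfolding presentation_at_def by blast
      then show ?thesis
        using rho_UNIV[OF pres[OF \<open>s \<in> nstates N\<close>] that] live[OF \<open>s \<in> nstates N\<close>] by metis
    qed
    then show ?thesis
      using profile_in_joint_actions[of "\<I> s" C] by auto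
  qed
  ultimately show ?thesis
    unfolding general_concurrent_game_frame_def class_frame_sel(1) by (intro conjI allI ballI)
qed

lemma class_frame_representable:
  assumes "\<And>s. s \<in> nstates N \<Longrightarrow> presentation_at N s (\<I> s)"
  shows "AC_representable (class_frame (nstates N) \<I>) N" (is "AC_representable ?G N")
proof -
  have "{out ?G C s \<sigma>C | \<sigma>C. \<sigma>C \<in> av ?G C s} = nbhd N C s" if "s \<in> nstates N" for C s
  proof -
    have "{out ?G C s \<sigma>C | \<sigma>C. \<sigma>C \<in> av ?G C s} =
        (\<lambda>i. out ?G C s (profile (\<I> s) C i)) ` idx (\<I> s)"
      unfolding class_frame_sel(3) by blast
    also have "\<dots> = rho (\<I> s) C ` idx (\<I> s)"
      using out_profile[where \<I> = \<I>, OF assms[OF that]] by (intro image_cong) simp_all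
    finally show ?thesis
      using assms[OF that] by (auto simp: presentation_at_def)
  qed
  then show ?thesis
    by (simp add: AC_representable_def del: class_frame_sel(3,4))
qed

lemma class_frame_independent:
  assumes pres: "\<And>s. s \<in> nstates N \<Longrightarrow> presentation_at N s (\<I> s)"
    and amal: "amalgamating N \<I>"
  shows "independent (class_frame (nstates N) \<I>)"
proof -
  have "profile (\<I> s) C i ++ profile (\<I> s) D j \<in> profile (\<I> s) (C \<union> D) ` idx (\<I> s)"
    if mem: "s \<in> nstates N" "C \<inter> D = {}" "i \<in> idx (\<I> s)" "j \<in> idx (\<I> s)" for s C D i j
  proof -
    obtain k where k: "k \<in> idx (\<I> s)"
        "(i, k) \<in> coalition_eqv (\<I> s) C" "(j, k) \<in> coalition_eqv (\<I> s) D"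
      using amal[unfolded amalgamating_def, rule_format, OF mem(1,3,4,2)] by blast
    have equiv: "equiv (idx (\<I> s)) (eqv (\<I> s) a)" for a
      using pres[OF mem(1)] unfolding presentation_at_def by blast
    \<comment> \<open>The joined profile takes its \<open>C\<close>-part and its
      \<open>D\<close>-part from the single index \<open>k\<close>, so it is the profile of
      \<open>k\<close> on the union of the two coalitions.\<close>
    have "profile (\<I> s) C i = profile (\<I> s) C k" "profile (\<I> s) D j = profile (\<I> s) D k"
      using k profile_eq_iff[OF equiv] mem(3,4) by blast+
    then show ?thesis
      using k(1) by (simp add: profile_Un)
  qed
  then show ?thesis
    by (auto simp: independent_def)
qed

text \<open>Seriality and determinism depend only on the outcomes of available joint actions, so
  this equation transfers them for any representing frame. Independence concerns the joint actions
  themselves and is shown for the class frame directly.\<close>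

lemma AC_representable_nbhd:
  "AC_representable G N \<Longrightarrow> s \<in> nstates N \<Longrightarrow> nbhd N C s = out G C s ` av G C s"
  unfolding AC_representable_def by blast

lemma AC_representable_serial_iff:
  "AC_representable G N \<Longrightarrow> serial G \<longleftrightarrow> AC_abstract_serial N"
  by (simp add: serial_def AC_abstract_serial_def AC_representable_nbhd)
    (auto simp: AC_representable_def)

lemma AC_representable_deterministic_iff:
  "AC_representable G N \<Longrightarrow> deterministic G \<longleftrightarrow> AC_abstract_deterministic N"
  by (simp add: deterministic_def AC_abstract_deterministic_def AC_representable_nbhd)
    (simp add: AC_representable_def)

theorem theorem6:
  fixes N :: "('ag::finite, 's) nbhd_frame"
    and X :: "frame_property list"
  assumes "X \<in> {[], [Serial], [Independent], [Deterministic],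
                [Serial, Independent], [Serial, Deterministic], [Independent, Deterministic],
                [Serial, Independent, Deterministic]}"
    and "AC_abstract_representative_X_frame TYPE('i) X N"
  shows "\<exists>G :: ('ag, 's, 'i set) action_frame.
           game_X_frame X G \<and> states G = nstates N \<and> AC_representable G N"
proof -
  have rep: "AC_abstract_representative TYPE('i) N"
    and ser: "Serial \<in> set X \<Longrightarrow> AC_abstract_serial N"
    and ind: "Independent \<in> set X \<Longrightarrow> AC_abstract_independent TYPE('i) N"
    and det: "Deterministic \<in> set X \<Longrightarrow> AC_abstract_deterministic N"
    using assms(2) by (auto simp: AC_abstract_representative_X_frame_def)
  \<comment> \<open>Representativeness and independence may be witnessed by different presentations.
    When independence is required, the amalgamating one is taken, so that one frame serves all
    properties.\<close>
  obtain \<I> :: "'s \<Rightarrow> ('ag, 's, 'i) presentation"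
    where \<I>: "abstract_actual_presentation N \<I>" "Independent \<in> set X \<longrightarrow> amalgamating N \<I>"
    using rep ind unfolding AC_abstract_representative_def AC_abstract_independent_def by blast
  have pres: "presentation_at N s (\<I> s)" if "s \<in> nstates N" for s
    using \<I>(1) that by (simp add: abstract_actual_presentation_def)
  let ?G = "class_frame (nstates N) \<I>"
  have repr: "AC_representable ?G N"
    using pres by (rule class_frame_representable)
  have "general_concurrent_game_frame ?G"
    using rep pres
    by (intro class_frame_general)
      (auto simp: AC_abstract_representative_def actual_nbhd_frame_def)
  moreover have "Independent \<in> set X \<Longrightarrow> independent ?G"
    using \<I>(2) class_frame_independent[OF pres] by blast
  ultimately have "game_X_frame X ?G"
    using ser det AC_representable_serial_iff[OF repr] AC_representable_deterministic_iff[OF repr]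
    by (simp add: game_X_frame_def)
  then show ?thesis
    using repr by (intro exI[of _ ?G]) simp
qed

end
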